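(* Let $n$ be a positive integer. Suppose that $(\mathcal{A},\mathcal{B})$ is an $(n,n)$-bounded 1-cross intersecting set pair system of size $m$ such that both $\mathcal{A}$ and $\mathcal{B}$ are linear hypergraphs. Then $m\le \frac{1}{2}n^2+n+1$.
   Context: A cross intersecting set pair system (SPS) of size $m\ge 2$ consists of finite sets $A_1,\dots,A_m$ and $B_1,\dots,B_m$ such that $A_i\cap B_i=\emptyset$ for every $1\le i\le m$ and $A_i\cap B_j\neq\emptyset$ for all $1\le i\neq j\le m$; one writes $\mathcal{A}=\{A_i\}_{i=1}^m$, $\mathcal{B}=\{B_i\}_{i=1}^m$. It is $(a,b)$-bounded if $|A_i|\le a$ and $|B_i|\le b$ for each $i$. It is 1-cross intersecting if $|A_i\cap B_j|=1$ for each $i\neq j$. A hypergraph is linear if any two different edges have at most one vertex in common; thus $\mathcal{A}$ (resp. $\mathcal{B}$) is linear when $|A_i\cap A_j|\le 1$ (resp. $|B_i\cap B_j|\le 1$) for all $i\ne j$. *)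

theory Defs
  imports Complex_Main
begin

(* The members A 1, ..., A m and B 1, ..., B m are the values of A and B on {1..m};
   values of A and B outside this range are irrelevant. *)
definition cross_intersecting_SPS ::
  "nat \<Rightarrow> (nat \<Rightarrow> 'a set) \<Rightarrow> (nat \<Rightarrow> 'a set) \<Rightarrow> bool" where
  "cross_intersecting_SPS m A B \<longleftrightarrow>
     m \<ge> 2 \<and>
     (\<forall>i\<in>{1..m}. finite (A i) \<and> finite (B i)) \<and>
     (\<forall>i\<in>{1..m}. A i \<inter> B i = {}) \<and>
     (\<forall>i\<in>{1..m}. \<forall>j\<in>{1..m}. i \<noteq> j \<longrightarrow> A i \<inter> B j \<noteq> {})"

definition bounded_SPS ::
  "nat \<Rightarrow> nat \<Rightarrow> nat \<Rightarrow> (nat \<Rightarrow> 'a set) \<Rightarrow> (nat \<Rightarrow> 'a set) \<Rightarrow> bool" where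
  "bounded_SPS a b m A B \<longleftrightarrow> (\<forall>i\<in>{1..m}. card (A i) \<le> a \<and> card (B i) \<le> b)"

definition one_cross_intersecting ::
  "nat \<Rightarrow> (nat \<Rightarrow> 'a set) \<Rightarrow> (nat \<Rightarrow> 'a set) \<Rightarrow> bool" where
  "one_cross_intersecting m A B \<longleftrightarrow>
     (\<forall>i\<in>{1..m}. \<forall>j\<in>{1..m}. i \<noteq> j \<longrightarrow> card (A i \<inter> B j) = 1)"

(* The condition ranges over distinct indices. In a cross intersecting set pair system
   distinct indices carry distinct edges: A i = A j would give
   A i \<inter> B j = A j \<inter> B j = {}. *)
definition linear_family :: "nat \<Rightarrow> (nat \<Rightarrow> 'a set) \<Rightarrow> bool" where
  "linear_family m F \<longleftrightarrow>
     (\<forall>i\<in>{1..m}. \<forall>j\<in>{1..m}. i \<noteq> j \<longrightarrow> card (F i \<inter> F j) \<le> 1)"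

end

theory Submission imports Defs begin

text \<open>
  For a point \<open>x\<close> let \<open>p\<close> and \<open>q\<close> be the numbers of \<open>A\<close>-edges and \<open>B\<close>-edges through it, and
  put \<open>r = p + q\<close>. As every \<open>A i\<close> meets every \<open>B j\<close> with \<open>j \<noteq> i\<close> in one point, double counting
  gives \<open>\<Sum>p q = m (m - 1)\<close>, while \<open>\<Sum>r \<le> 2 n m\<close> by boundedness. If \<open>r \<le> n + 2\<close> held at every
  point, then \<open>4 p q \<le> r\<^sup>2 \<le> (n + 2) r\<close> would sum up to the bound \<open>2 (m - 1) \<le> n (n + 2)\<close>. The
  pointwise inequality can fail, but in a system large enough to threaten
  the bound it holds on average, in the form \<open>\<Sum>r\<^sup>2 \<le> (n + 2) \<Sum>r\<close>.

  The average is controlled by the missed pairs: ordered pairs of \<open>A\<close>-edges, or of \<open>B\<close>-edges, that are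
  disjoint. A lower and an upper estimate for their number \<open>D\<close> are combined.

  First, points with large \<open>r\<close> force missed pairs (\<open>star_missed_lower\<close>). The \<open>A\<close>-edges through
  \<open>x\<close> are disjoint apart from \<open>x\<close>, so are the \<open>B\<close>-edges through \<open>x\<close>, and the two groups share
  only \<open>x\<close>. An edge \<open>A k\<close> with \<open>x\<close> in neither \<open>A k\<close> nor \<open>B k\<close> must spend a separate point on each of the \<open>q\<close>
  \<open>B\<close>-edges, which leaves at most \<open>n - q\<close> points to meet the \<open>p\<close> \<open>A\<close>-edges, so it misses at least
  \<open>r - n\<close> of them. Over all \<open>k\<close>, and for both families, about \<open>2 m (r - n)\<close> pairs with one edge
  through \<open>x\<close> are missed.

  Second, there are few missed pairs (\<open>sum_missed_le\<close>). Linearity turns each pair that is not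
  missed into exactly one common point, so \<open>D \<le> \<Sum>r - \<Sum>(p - q)\<^sup>2 \<le> \<Sum>r\<close>.

  The local estimates are added up with weight \<open>r\<close>. A missed pair at an edge is then counted with
  the total of \<open>r\<close> over that edge, which is at most \<open>2 m - 2 + n\<close>, about \<open>2 m\<close>. The factors of
  about \<open>2 m\<close> cancel up to a multiplicative error of at most 2, so \<open>\<Sum>r (r - n) \<le> 2 D \<le> 2 \<Sum>r\<close>
  (\<open>card_K_le\<close>). The error is under control once \<open>m \<ge> 5 n / 2 + 1\<close> and \<open>m \<ge> 2 n + 2\<close>, and a
  system exceeding the bound satisfies both when \<open>n \<ge> 2\<close>.
\<close>

section \<open>Stars and missed edges\<close>

definition star :: "'i set \<Rightarrow> ('i \<Rightarrow> 'a set) \<Rightarrow> 'a \<Rightarrow> 'i set" where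
  "star K F x = {i\<in>K. x \<in> F i}"

definition missed :: "'i set \<Rightarrow> ('i \<Rightarrow> 'a set) \<Rightarrow> 'i \<Rightarrow> 'i set" where
  "missed K F i = {k\<in>K. k \<noteq> i \<and> F k \<inter> F i = {}}"

abbreviation petals :: "'i set \<Rightarrow> ('i \<Rightarrow> 'a set) \<Rightarrow> 'a \<Rightarrow> 'a set" where
  "petals K F x \<equiv> (\<Union>i\<in>star K F x. F i - {x})"

lemma finite_star [simp]: "finite K \<Longrightarrow> finite (star K F x)"
  by (simp add: star_def)

lemma finite_missed [simp]: "finite K \<Longrightarrow> finite (missed K F i)"
  by (simp add: missed_def)

lemma int_card_Diff_singleton:
  "finite X \<Longrightarrow> int (card (X - {k})) = int (card X) - (if k \<in> X then 1 else 0)"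
  by (auto dest: card_Suc_Diff1)

lemma sum_over_stars:
  fixes g :: "'a \<Rightarrow> 'i \<Rightarrow> int"
  assumes "finite K" "finite V" "\<And>i. i \<in> K \<Longrightarrow> F i \<subseteq> V"
  shows "(\<Sum>x\<in>V. \<Sum>i\<in>star K F x. g x i) = (\<Sum>i\<in>K. \<Sum>x\<in>F i. g x i)"
proof -
  have "(\<Sum>x\<in>V. \<Sum>i\<in>star K F x. g x i) = (\<Sum>i\<in>K. \<Sum>x\<in>{x\<in>V. x \<in> F i}. g x i)"
    unfolding star_def using assms(1,2) by (intro sum.swap_restrict) auto
  also have "\<dots> = (\<Sum>i\<in>K. \<Sum>x\<in>F i. g x i)"
    using assms(3) by (intro sum.cong) auto
  finally show ?thesis .
qed

lemma sum_card_star: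
  assumes "finite K" "finite X"
  shows "(\<Sum>x\<in>X. int (card (star K F x))) = (\<Sum>i\<in>K. int (card (X \<inter> F i)))"
proof -
  have "(\<Sum>x\<in>X. int (card (star K F x))) = (\<Sum>x\<in>X. \<Sum>i | i \<in> K \<and> x \<in> F i. 1)"
    by (simp add: star_def)
  also have "\<dots> = (\<Sum>i\<in>K. \<Sum>x | x \<in> X \<and> x \<in> F i. 1)"
    using assms by (intro sum.swap_restrict) auto
  also have "\<dots> = (\<Sum>i\<in>K. int (card (X \<inter> F i)))"
    by (simp add: Int_def)
  finally show ?thesis .
qed

text \<open>
  A sunflower with kernel inside \<open>{x}\<close> can only be hit by a set avoiding \<open>x\<close> if that set spends
  a separate point on every petal.
\<close>

lemma card_le_trace_of_petals:
  assumes "finite C" "x \<notin> C"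
    and meet: "\<And>i. i \<in> L \<Longrightarrow> F i \<inter> C \<noteq> {}"
    and petal: "\<And>i j. i \<in> L \<Longrightarrow> j \<in> L \<Longrightarrow> i \<noteq> j \<Longrightarrow> F i \<inter> F j \<subseteq> {x}"
  shows "card L \<le> card (C \<inter> (\<Union>i\<in>L. F i - {x}))"
proof -
  have "\<forall>i\<in>L. \<exists>y. y \<in> F i \<inter> C" using meet by blast
  then obtain h where h: "\<And>i. i \<in> L \<Longrightarrow> h i \<in> F i \<inter> C" by metis
  have "inj_on h L"
  proof (rule inj_onI, rule ccontr)
    fix i j assume ij: "i \<in> L" "j \<in> L" "h i = h j" "i \<noteq> j"
    then have "h i \<in> F i \<inter> F j" using h[of i] h[of j] by auto
    then have "h i = x" using petal ij by blast
    then show False using h[OF \<open>i \<in> L\<close>] \<open>x \<notin> C\<close> by auto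
  qed
  moreover have "h ` L \<subseteq> C \<inter> (\<Union>i\<in>L. F i - {x})"
    using h \<open>x \<notin> C\<close> by fastforce
  ultimately show ?thesis using \<open>finite C\<close> by (intro card_inj_on_le) auto
qed

section \<open>Degrees in a linear 1-cross intersecting system\<close>

text \<open>
  The hypotheses are symmetric in the two families, so every fact about \<open>A\<close> below also serves for
  \<open>B\<close> through \<open>swap\<close>.
\<close>

locale linear_one_cross =
  fixes K :: "'i set" and A B :: "'i \<Rightarrow> 'a set" and n :: nat
  assumes finite_K: "finite K"
    and finite_A: "i \<in> K \<Longrightarrow> finite (A i)"
    and finite_B: "i \<in> K \<Longrightarrow> finite (B i)"
    and card_A: "i \<in> K \<Longrightarrow> card (A i) \<le> n"
    and card_B: "i \<in> K \<Longrightarrow> card (B i) \<le> n"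
    and disjoint: "i \<in> K \<Longrightarrow> A i \<inter> B i = {}"
    and cross: "i \<in> K \<Longrightarrow> j \<in> K \<Longrightarrow> i \<noteq> j \<Longrightarrow> card (A i \<inter> B j) = 1"
    and linear_A: "i \<in> K \<Longrightarrow> j \<in> K \<Longrightarrow> i \<noteq> j \<Longrightarrow> card (A i \<inter> A j) \<le> 1"
    and linear_B: "i \<in> K \<Longrightarrow> j \<in> K \<Longrightarrow> i \<noteq> j \<Longrightarrow> card (B i \<inter> B j) \<le> 1"
begin

lemma swap: "linear_one_cross K B A n"
  using finite_K finite_A finite_B card_A card_B disjoint cross linear_A linear_B
  by unfold_locales (auto simp: Int_commute)

abbreviation "m \<equiv> int (card K)"
abbreviation "p x \<equiv> int (card (star K A x))"
abbreviation "q x \<equiv> int (card (star K B x))"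
abbreviation "r x \<equiv> p x + q x"

lemma stars_disjoint: "star K A x \<inter> star K B x = {}"
  using disjoint by (auto simp: star_def)

lemma A_petals:
  assumes "i \<in> star K A x" "j \<in> star K A x" "i \<noteq> j"
  shows "A i \<inter> A j \<subseteq> {x}"
proof -
  have "i \<in> K" "j \<in> K" and x: "x \<in> A i \<inter> A j" using assms by (auto simp: star_def)
  then have "card (A i \<inter> A j) \<le> Suc 0" using linear_A assms(3) by simp
  then show ?thesis using x finite_A[OF \<open>i \<in> K\<close>] by (auto simp: card_le_Suc0_iff_eq)
qed

lemma B_petals: "i \<in> star K B x \<Longrightarrow> j \<in> star K B x \<Longrightarrow> i \<noteq> j \<Longrightarrow> B i \<inter> B j \<subseteq> {x}"
  by (rule linear_one_cross.A_petals[OF swap])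

text \<open>
  An \<open>A\<close>-edge and a \<open>B\<close>-edge through \<open>x\<close> have different indices, so \<open>x\<close> is already their unique
  common point.
\<close>

lemma petals_disjoint: "petals K A x \<inter> petals K B x = {}"
proof -
  { fix i j y assume i: "i \<in> star K A x" and j: "j \<in> star K B x" and y: "y \<in> A i" "y \<in> B j"
    then have "i \<noteq> j" "i \<in> K" "j \<in> K" using stars_disjoint by (auto simp: star_def)
    then have "card (A i \<inter> B j) = 1" using cross by blast
    moreover have "x \<in> A i \<inter> B j" "y \<in> A i \<inter> B j" using i j y by (auto simp: star_def)
    ultimately have "y = x" by (metis card_1_singletonE singletonD) }
  then show ?thesis by blast
qed

lemma star_B_le_trace:
  assumes "k \<in> K" "x \<notin> A k"
  shows "card (star K B x - {k}) \<le> card (A k \<inter> petals K B x)"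
proof -
  have "card (star K B x - {k}) \<le> card (A k \<inter> (\<Union>i\<in>star K B x - {k}. B i - {x}))"
  proof (rule card_le_trace_of_petals)
    fix i assume "i \<in> star K B x - {k}"
    then have "card (A k \<inter> B i) = 1" using cross assms(1) by (auto simp: star_def)
    then show "B i \<inter> A k \<noteq> {}" by (auto simp: Int_commute)
  next
    fix i j assume "i \<in> star K B x - {k}" "j \<in> star K B x - {k}" "i \<noteq> j"
    then show "B i \<inter> B j \<subseteq> {x}" using B_petals by blast
  qed (use assms finite_A in auto)
  also have "\<dots> \<le> card (A k \<inter> petals K B x)"
    using finite_A[OF assms(1)] by (intro card_mono) auto
  finally show ?thesis .
qed

text \<open>
  The points of \<open>A k\<close> that meet \<open>A\<close>-edges through \<open>x\<close> and those that meet \<open>B\<close>-edges through \<open>x\<close>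
  are different, by \<open>petals_disjoint\<close>, and compete for the at most \<open>n\<close> places in \<open>A k\<close>. The index
  \<open>k\<close> is removed because \<open>A k\<close> and \<open>B k\<close> are disjoint.
\<close>

lemma meeting_star_le:
  assumes "k \<in> K" "x \<notin> A k"
  shows "card {i \<in> star K A x. A i \<inter> A k \<noteq> {}} + card (star K B x - {k}) \<le> n"
proof -
  let ?L = "{i \<in> star K A x. A i \<inter> A k \<noteq> {}}"
  have fin: "finite (A k)" using finite_A assms(1) by blast
  have "card ?L \<le> card (A k \<inter> (\<Union>i\<in>?L. A i - {x}))"
    using assms fin A_petals by (intro card_le_trace_of_petals) auto
  also have "\<dots> \<le> card (A k \<inter> petals K A x)"
    using fin by (intro card_mono) auto
  finally have "card ?L + card (star K B x - {k})
      \<le> card (A k \<inter> petals K A x) + card (A k \<inter> petals K B x)"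
    using star_B_le_trace[OF assms] by linarith
  also have "\<dots> = card (A k \<inter> petals K A x \<union> A k \<inter> petals K B x)"
    using fin petals_disjoint[of x] by (intro card_Un_disjoint[symmetric]) auto
  also have "\<dots> \<le> card (A k)" using fin by (intro card_mono) auto
  also have "\<dots> \<le> n" using card_A assms(1) by blast
  finally show ?thesis .
qed

text \<open>
  Each of the \<open>m - p\<close> edges \<open>A k\<close> avoiding \<open>x\<close> misses at least \<open>r - n\<close> edges of the star by
  \<open>meeting_star_le\<close>, up to a correction. The term \<open>q\<close> comes from the \<open>q\<close> indices \<open>k\<close> with \<open>x \<in> B k\<close>, for which
  \<open>A k\<close> needs to meet only \<open>q - 1\<close> of the \<open>B\<close>-edges through \<open>x\<close>.
\<close>

lemma star_missed_lower:
  "(m - p x) * (r x - int n) - q x \<le> (\<Sum>i\<in>star K A x. int (card (missed K A i)))"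
proof -
  let ?I = "star K A x" and ?J = "star K B x"
  have sub: "?I \<subseteq> K" "?J \<subseteq> K - ?I"
    using stars_disjoint[of x] by (auto simp: star_def)
  have fin: "finite K" "finite ?I" "finite ?J" using finite_K by auto
  have one: "r x - int n - (if k \<in> ?J then 1 else 0)
      \<le> int (card {i\<in>?I. k \<noteq> i \<and> A k \<inter> A i = {}})" if k: "k \<in> K - ?I" for k
  proof -
    have x: "x \<notin> A k" "k \<in> K" using k by (auto simp: star_def)
    have "?I = {i\<in>?I. A i \<inter> A k \<noteq> {}} \<union> {i\<in>?I. k \<noteq> i \<and> A k \<inter> A i = {}}"
      using k by auto
    then have "card ?I \<le> card {i\<in>?I. A i \<inter> A k \<noteq> {}} + card {i\<in>?I. k \<noteq> i \<and> A k \<inter> A i = {}}"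
      by (metis (no_types, lifting) card_Un_le)
    moreover have "int (card (?J - {k})) = q x - (if k \<in> ?J then 1 else 0)"
      using fin by (intro int_card_Diff_singleton)
    ultimately show ?thesis using meeting_star_le[OF x(2,1)] by linarith
  qed
  have cK: "int (card (K - ?I)) = m - p x"
    using fin sub by (simp add: card_Diff_subset of_nat_diff card_mono)
  have cJ: "(\<Sum>k\<in>K - ?I. if k \<in> ?J then 1 else 0) = q x"
    using fin sub by (simp add: sum.If_cases Int_absorb1)
  have "(m - p x) * (r x - int n) - q x
      = (\<Sum>k\<in>K - ?I. r x - int n - (if k \<in> ?J then 1 else 0))"
    using cK cJ by (simp add: sum_subtractf)
  also have "\<dots> \<le> (\<Sum>k\<in>K - ?I. int (card {i\<in>?I. k \<noteq> i \<and> A k \<inter> A i = {}}))"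
    by (intro sum_mono one)
  also have "\<dots> \<le> (\<Sum>k\<in>K. int (card {i\<in>?I. k \<noteq> i \<and> A k \<inter> A i = {}}))"
    using fin by (intro sum_mono2) auto
  also have "\<dots> = (\<Sum>k\<in>K. \<Sum>i\<in>{i\<in>?I. k \<noteq> i \<and> A k \<inter> A i = {}}. 1)" by simp
  also have "\<dots> = (\<Sum>i\<in>?I. \<Sum>k\<in>{k\<in>K. k \<noteq> i \<and> A k \<inter> A i = {}}. 1)"
    using fin by (intro sum.swap_restrict) auto
  also have "\<dots> = (\<Sum>i\<in>?I. int (card (missed K A i)))" by (simp add: missed_def)
  finally show ?thesis .
qed

lemma B_degree_le: assumes "k \<in> K" "k \<notin> star K A x" "k \<notin> star K B x" shows "q x \<le> int n"
  using meeting_star_le[of k x] assms by (auto simp: star_def)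

text \<open>
  If \<open>x \<in> A i\<close>, then \<open>B i\<close> spends \<open>p - 1\<close> points on the other \<open>A\<close>-edges through \<open>x\<close>, so
  \<open>p \<le> n + 1\<close>, and likewise \<open>q \<le> n + 1\<close>. Both cannot be equalities: for \<open>x \<in> A i\<close> and
  \<open>x \<in> B j\<close> the common point of \<open>A j\<close> and \<open>B i\<close> cannot lie in petals of both kinds, so it is
  a wasted point for one of the two edges.
\<close>

lemma degree_sum_le_Suc: "r x \<le> 2 * int n + 1"
proof -
  interpret swap: linear_one_cross K B A n by (rule swap)
  have minus: "card (star K F x - {i}) = card (star K F x) - 1" if "i \<in> star K F x"
    for F :: "'i \<Rightarrow> 'a set" and i
    using that finite_K by simp
  have P: "card (star K A x) - 1 \<le> card (B i \<inter> petals K A x)" "card (B i \<inter> petals K A x) \<le> n"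
    if "i \<in> star K A x" for i
    using that swap.star_B_le_trace[of i x] minus[OF that] disjoint[of i] finite_B[of i]
      card_B[of i] card_mono[of "B i" "B i \<inter> petals K A x"]
    by (auto simp: star_def)
  have Q: "card (star K B x) - 1 \<le> card (A j \<inter> petals K B x)" "card (A j \<inter> petals K B x) \<le> n"
    if "j \<in> star K B x" for j
    using that star_B_le_trace[of j x] minus[OF that] disjoint[of j] finite_A[of j]
      card_A[of j] card_mono[of "A j" "A j \<inter> petals K B x"]
    by (auto simp: star_def)
  show ?thesis
  proof (cases "star K A x = {} \<or> star K B x = {}")
    case True
    then show ?thesis
    proof (elim disjE)
      assume e: "star K A x = {}"
      show ?thesis
      proof (cases "star K B x = {}")
        case False
        then obtain j where "j \<in> star K B x" by blast
        from Q[OF this] show ?thesis using e by simp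
      qed (simp add: e)
    next
      assume e: "star K B x = {}"
      show ?thesis
      proof (cases "star K A x = {}")
        case False
        then obtain i where "i \<in> star K A x" by blast
        from P[OF this] show ?thesis using e by simp
      qed (simp add: e)
    qed
  next
    case False
    then obtain i j where i: "i \<in> star K A x" and j: "j \<in> star K B x" by blast
    then have K: "i \<in> K" "j \<in> K" "i \<noteq> j" using stars_disjoint by (auto simp: star_def)
    then have "card (A j \<inter> B i) = 1" using cross by simp
    then obtain z where z: "z \<in> A j" "z \<in> B i" by (auto simp: card_1_singleton_iff)
    have strict: "card (C \<inter> P) < n" if "finite C" "card C \<le> n" "z \<in> C" "z \<notin> P" for C P :: "'a set"
    proof -
      have "C \<inter> P \<subset> C" using that by blast
      from psubset_card_mono[OF that(1) this] that(2) show ?thesis by linarith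
    qed
    have "card (B i \<inter> petals K A x) < n \<or> card (A j \<inter> petals K B x) < n"
      using petals_disjoint[of x] strict[OF finite_B card_B, OF K(1) K(1) z(2)]
        strict[OF finite_A card_A, OF K(2) K(2) z(1)] by blast
    then show ?thesis using P[OF i] Q[OF j] by linarith
  qed
qed

text \<open>
  When \<open>K\<close> is larger than the bound of \<open>degree_sum_le_Suc\<close>, some index \<open>k\<close> has \<open>x\<close> neither in
  \<open>A k\<close> nor in \<open>B k\<close>, and these two edges improve both degree bounds to \<open>n\<close>.
\<close>

lemma degree_sum_le:
  assumes "2 * n + 2 \<le> card K"
  shows "r x \<le> 2 * int n"
proof -
  have "card (star K A x \<union> star K B x) \<le> card (star K A x) + card (star K B x)"
    by (rule card_Un_le)
  then have "card (star K A x \<union> star K B x) < card K" using degree_sum_le_Suc[of x] assms by linarith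
  then have "\<not> K \<subseteq> star K A x \<union> star K B x"
    using finite_K by (metis card_mono finite_Un finite_star not_le)
  then obtain k where k: "k \<in> K" "k \<notin> star K A x" "k \<notin> star K B x" by blast
  show ?thesis using B_degree_le[OF k] linear_one_cross.B_degree_le[OF swap k(1,3,2)] by linarith
qed

section \<open>Double counting\<close>

lemma sum_B_degrees_on_A:
  assumes "i \<in> K"
  shows "(\<Sum>x\<in>A i. q x) = m - 1"
proof -
  have "(\<Sum>x\<in>A i. q x) = (\<Sum>j\<in>K. int (card (A i \<inter> B j)))"
    using finite_K finite_A[OF assms] by (rule sum_card_star)
  also have "\<dots> = (\<Sum>j\<in>K - {i}. int (card (A i \<inter> B j)))"
    using finite_K assms disjoint by (simp add: sum.remove)
  also have "\<dots> = (\<Sum>j\<in>K - {i}. 1)"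
    using cross[OF assms] by (intro sum.cong) auto
  also have "\<dots> = int (card (K - {i}))" by simp
  also have "\<dots> = m - 1"
    using assms by (simp only: int_card_Diff_singleton[OF finite_K] if_True)
  finally show ?thesis .
qed

text \<open>
  Summing the \<open>A\<close>-degrees over \<open>A i\<close> counts \<open>A i\<close> itself \<open>card (A i)\<close> times and, by linearity,
  every other edge at most once, and a missed edge not at all.
\<close>

lemma sum_A_degrees_on_A_missed:
  assumes "i \<in> K"
  shows "(\<Sum>x\<in>A i. p x) + int (card (missed K A i)) \<le> int (card (A i)) + m - 1"
proof -
  have "(\<Sum>x\<in>A i. p x) = (\<Sum>j\<in>K. int (card (A i \<inter> A j)))"
    using finite_K finite_A[OF assms] by (rule sum_card_star)
  also have "\<dots> = int (card (A i)) + (\<Sum>j\<in>K - {i}. int (card (A i \<inter> A j)))"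
    using finite_K assms by (simp add: sum.remove)
  also have "(\<Sum>j\<in>K - {i}. int (card (A i \<inter> A j)))
      \<le> (\<Sum>j\<in>K - {i}. 1 - (if j \<in> missed K A i then 1 else 0))"
    using linear_A[OF assms] by (intro sum_mono) (auto simp: missed_def Int_commute)
  also have "\<dots> = int (card (K - {i})) - int (card (missed K A i))"
  proof -
    have "(K - {i}) \<inter> missed K A i = missed K A i" by (auto simp: missed_def)
    then show ?thesis using finite_K by (simp add: sum_subtractf sum.If_cases)
  qed
  also have "int (card (K - {i})) = m - 1"
    using assms by (simp only: int_card_Diff_singleton[OF finite_K] if_True)
  finally show ?thesis by linarith
qed

definition V where "V = (\<Union>i\<in>K. A i \<union> B i)"

lemma finite_V: "finite V"
  using finite_K finite_A finite_B by (auto simp: V_def)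

lemma V_swap: "linear_one_cross.V K B A = V"
  by (auto simp: linear_one_cross.V_def[OF swap] V_def)

lemma sum_weighted_A_degrees: "(\<Sum>x\<in>V. g x * p x) = (\<Sum>i\<in>K. \<Sum>x\<in>A i. g x)" for g :: "'a \<Rightarrow> int"
proof -
  have "(\<Sum>x\<in>V. g x * p x) = (\<Sum>x\<in>V. \<Sum>i\<in>star K A x. g x)" by (simp add: mult.commute)
  also have "\<dots> = (\<Sum>i\<in>K. \<Sum>x\<in>A i. g x)"
    by (rule sum_over_stars[OF finite_K finite_V]) (auto simp: V_def)
  finally show ?thesis .
qed

lemma sum_degree_products: "(\<Sum>x\<in>V. q x * p x) = m * (m - 1)"
  unfolding sum_weighted_A_degrees by (simp add: sum_B_degrees_on_A)

lemma sum_A_degrees: "(\<Sum>x\<in>V. p x) = (\<Sum>i\<in>K. int (card (A i)))"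
  using sum_weighted_A_degrees[of "\<lambda>_. 1"] by simp

lemma sum_missed_le:
  "(\<Sum>i\<in>K. int (card (missed K A i))) + (\<Sum>x\<in>V. p x * p x) \<le> (\<Sum>x\<in>V. p x) + m * (m - 1)"
proof -
  have "(\<Sum>i\<in>K. int (card (missed K A i))) + (\<Sum>x\<in>V. p x * p x)
      = (\<Sum>i\<in>K. (\<Sum>x\<in>A i. p x) + int (card (missed K A i)))"
    by (simp add: sum_weighted_A_degrees sum.distrib)
  also have "\<dots> \<le> (\<Sum>i\<in>K. int (card (A i)) + (m - 1))"
    by (intro sum_mono) (use sum_A_degrees_on_A_missed in force)
  also have "\<dots> = (\<Sum>x\<in>V. p x) + m * (m - 1)"
    by (simp add: sum.distrib sum_A_degrees)
  finally show ?thesis .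
qed

text \<open>
  Exchanging the sums weights each edge \<open>A i\<close> by \<open>\<Sum>x\<in>A i. r x\<close>, whose \<open>B\<close>-part is \<open>m - 1\<close> and
  whose \<open>A\<close>-part is at most \<open>n + m - 1\<close>.
\<close>

lemma sum_weighted_missed_le:
  "(\<Sum>x\<in>V. r x * (\<Sum>i\<in>star K A x. int (card (missed K A i))))
    \<le> (2 * m - 2 + int n) * (\<Sum>i\<in>K. int (card (missed K A i)))"
proof -
  let ?s = "\<lambda>i. int (card (missed K A i))"
  have "(\<Sum>x\<in>V. r x * (\<Sum>i\<in>star K A x. ?s i)) = (\<Sum>x\<in>V. \<Sum>i\<in>star K A x. r x * ?s i)"
    by (simp add: sum_distrib_left)
  also have "\<dots> = (\<Sum>i\<in>K. \<Sum>x\<in>A i. r x * ?s i)"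
    by (rule sum_over_stars[OF finite_K finite_V]) (auto simp: V_def)
  also have "\<dots> = (\<Sum>i\<in>K. (\<Sum>x\<in>A i. r x) * ?s i)"
    by (simp add: sum_distrib_right)
  also have "\<dots> \<le> (\<Sum>i\<in>K. (2 * m - 2 + int n) * ?s i)"
  proof (intro sum_mono mult_right_mono)
    fix i assume i: "i \<in> K"
    show "(\<Sum>x\<in>A i. r x) \<le> 2 * m - 2 + int n"
      using sum_B_degrees_on_A[OF i] sum_A_degrees_on_A_missed[OF i] card_A[OF i] by (simp add: sum.distrib)
  qed simp
  finally show ?thesis by (simp add: sum_distrib_left)
qed

text \<open>
  The estimates of \<open>star_missed_lower\<close> for the two families add up to \<open>(2 m - r) (r - n) - r\<close>. With \<open>u = r - n\<close>,
  twice this exceeds \<open>(2 m - 2 + n) u\<close> by \<open>(2 m - 3 n - 2 u) u - 2 n\<close>, which is at least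
  \<open>2 (u - 1) (n - u)\<close> when \<open>2 m \<ge> 5 n + 2\<close>, hence nonnegative in the range \<open>1 \<le> u \<le> n\<close> left by
  \<open>degree_sum_le\<close>. For \<open>u \<le> 0\<close> the claim holds because the number of missed pairs is nonnegative.
  The factor \<open>2 m - 2 + n\<close> is chosen to cancel against \<open>sum_weighted_missed_le\<close>.
\<close>

lemma excess_le_missed:
  assumes large: "2 * n + 2 \<le> card K" "5 * n + 2 \<le> 2 * card K"
  shows "(2 * m - 2 + int n) * (r x - int n)
    \<le> 2 * ((\<Sum>i\<in>star K A x. int (card (missed K A i))) +
           (\<Sum>i\<in>star K B x. int (card (missed K B i))))" (is "_ \<le> 2 * ?f")
proof (cases "r x \<le> int n")
  case True
  have "(2 * m - 2 + int n) * (r x - int n) \<le> 0"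
    using True large by (intro mult_nonneg_nonpos) auto
  also have "0 \<le> 2 * ?f" by (simp add: sum_nonneg)
  finally show ?thesis .
next
  case False
  define u where "u = r x - int n"
  have r: "r x = u + int n" by (simp add: u_def)
  have u: "1 \<le> u" "u \<le> int n" using False degree_sum_le[OF large(1), of x] by (auto simp: u_def)
  have "0 \<le> 2 * ((u - 1) * (int n - u))" using u by simp
  also have "\<dots> = (2 * int n + 2 - 2 * u) * u - 2 * int n" by (simp add: algebra_simps)
  also have "\<dots> \<le> (2 * m - 3 * int n - 2 * u) * u - 2 * int n"
    using u large(2) by (intro diff_right_mono mult_right_mono) auto
  also have "\<dots> = 2 * ((2 * m - r x) * u - r x) - (2 * m - 2 + int n) * u"
    unfolding r by (simp add: algebra_simps)
  finally have "(2 * m - 2 + int n) * u \<le> 2 * ((2 * m - r x) * u - r x)" by simp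
  also have "(2 * m - r x) * u - r x
      = ((m - p x) * (r x - int n) - q x) + ((m - q x) * (q x + p x - int n) - p x)"
    unfolding u_def by (simp add: algebra_simps)
  also have "\<dots> \<le> ?f"
    by (intro add_mono star_missed_lower linear_one_cross.star_missed_lower[OF swap])
  finally show ?thesis by (simp add: u_def)
qed

lemma card_K_le:
  assumes large: "2 * n + 2 \<le> card K" "5 * n + 2 \<le> 2 * card K"
  shows "2 * card K \<le> n * (n + 2) + 2"
proof -
  define s where "s i = int (card (missed K A i))" for i
  define t where "t i = int (card (missed K B i))" for i
  define D where "D = (\<Sum>i\<in>K. s i) + (\<Sum>i\<in>K. t i)"
  define R where "R = (\<Sum>x\<in>V. r x)"
  define c where "c = 2 * m - 2 + int n"
  have "c > 0" using large by (auto simp: c_def)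
  have "c * (\<Sum>x\<in>V. r x * (r x - int n)) = (\<Sum>x\<in>V. r x * (c * (r x - int n)))"
    by (simp add: sum_distrib_left mult.left_commute)
  also have "\<dots> \<le> (\<Sum>x\<in>V. r x * (2 * ((\<Sum>i\<in>star K A x. s i) + (\<Sum>i\<in>star K B x. t i))))"
    unfolding c_def s_def t_def
    by (intro sum_mono mult_left_mono excess_le_missed large) auto
  also have "\<dots> = 2 * ((\<Sum>x\<in>V. r x * (\<Sum>i\<in>star K A x. s i))
                     + (\<Sum>x\<in>V. (q x + p x) * (\<Sum>i\<in>star K B x. t i)))"
    unfolding sum_distrib_left[of 2] sum.distrib[symmetric]
    by (intro sum.cong) (simp_all add: algebra_simps)
  also have "\<dots> \<le> 2 * (c * (\<Sum>i\<in>K. s i) + c * (\<Sum>i\<in>K. t i))"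
    unfolding c_def s_def t_def
    using sum_weighted_missed_le linear_one_cross.sum_weighted_missed_le[OF swap]
    by (simp add: V_swap)
  also have "\<dots> = c * (2 * D)" by (simp add: D_def algebra_simps)
  finally have 1: "(\<Sum>x\<in>V. r x * (r x - int n)) \<le> 2 * D"
    using \<open>c > 0\<close> by simp
  have pq: "m * (m - 1) = (\<Sum>x\<in>V. p x * q x)" using sum_degree_products by (simp add: mult.commute)
  have "D + (\<Sum>x\<in>V. p x * p x) + (\<Sum>x\<in>V. q x * q x) \<le> R + 2 * (\<Sum>x\<in>V. p x * q x)"
    using sum_missed_le linear_one_cross.sum_missed_le[OF swap] pq
    by (simp add: V_swap D_def R_def s_def t_def sum.distrib)
  then have "D + (\<Sum>x\<in>V. (p x - q x)\<^sup>2) \<le> R"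
    by (simp add: power2_eq_square algebra_simps sum.distrib sum_subtractf sum_distrib_left)
  moreover have "0 \<le> (\<Sum>x\<in>V. (p x - q x)\<^sup>2)" by (intro sum_nonneg) simp
  ultimately have 2: "D \<le> R" by linarith
  have "(\<Sum>i\<in>K. int (card (A i))) \<le> (\<Sum>i\<in>K. int n)" "(\<Sum>i\<in>K. int (card (B i))) \<le> (\<Sum>i\<in>K. int n)"
    by (intro sum_mono; simp add: card_A card_B)+
  then have 3: "R \<le> 2 * int n * m"
    using sum_A_degrees linear_one_cross.sum_A_degrees[OF swap]
    unfolding R_def sum.distrib V_swap by (simp add: algebra_simps)
  have "4 * (m * (m - 1)) = (\<Sum>x\<in>V. 4 * (p x * q x))" by (simp add: pq sum_distrib_left)
  also have "\<dots> \<le> (\<Sum>x\<in>V. r x * r x)"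
  proof (intro sum_mono)
    fix x show "4 * (p x * q x) \<le> r x * r x"
      using zero_le_power2[of "p x - q x"] by (simp add: power2_eq_square algebra_simps)
  qed
  also have "\<dots> = (\<Sum>x\<in>V. r x * (r x - int n)) + int n * R"
    by (simp add: R_def sum_distrib_left sum.distrib[symmetric] algebra_simps)
  also have "\<dots> \<le> (int n + 2) * R" using 1 2 by (simp add: algebra_simps)
  also have "\<dots> \<le> (int n + 2) * (2 * int n * m)" using 3 by (intro mult_left_mono) auto
  finally have "(2 * m) * (2 * (m - 1)) \<le> (2 * m) * (int n * (int n + 2))"
    by (simp add: algebra_simps)
  moreover have "m > 0" using large by simp
  ultimately have "2 * (m - 1) \<le> int n * (int n + 2)" by simp
  then have "int (2 * card K) \<le> int (n * (n + 2) + 2)" by (simp add: algebra_simps)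
  then show ?thesis by linarith
qed

end

section \<open>The bound\<close>

text \<open>
  With edges of size at most 1, three indices would force \<open>A i = B j\<close>, \<open>A i = B k\<close> and
  \<open>A j = B k\<close> to be one and the same point, so \<open>A j\<close> would meet \<open>B j\<close>.
\<close>

lemma two_le_of_card_ge_3:
  assumes "linear_one_cross K A B n" "3 \<le> card K"
  shows "2 \<le> n"
proof (rule ccontr)
  assume "\<not> 2 \<le> n"
  interpret linear_one_cross K A B n by fact
  obtain i j k where K: "i \<in> K" "j \<in> K" "k \<in> K" and ne: "i \<noteq> j" "i \<noteq> k" "j \<noteq> k"
    using assms(2) by (auto simp: card_le_Suc_iff numeral_3_eq_3)
  have uniq: "y = z" if "l \<in> K" "y \<in> A l" "z \<in> A l" for l y z
    using card_A[OF that(1)] finite_A[OF that(1)] \<open>\<not> 2 \<le> n\<close> that card_le_Suc0_iff_eq[of "A l"] by auto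
  have uniq': "y = z" if "l \<in> K" "y \<in> B l" "z \<in> B l" for l y z
    using card_B[OF that(1)] finite_B[OF that(1)] \<open>\<not> 2 \<le> n\<close> that card_le_Suc0_iff_eq[of "B l"] by auto
  have ex: "\<exists>y. y \<in> A l \<and> y \<in> B l'" if "l \<in> K" "l' \<in> K" "l \<noteq> l'" for l l'
    using cross[OF that] by (auto simp: card_1_singleton_iff)
  obtain a where a: "a \<in> A i" "a \<in> B j" using ex K ne by blast
  obtain b where b: "b \<in> A i" "b \<in> B k" using ex K ne by blast
  obtain c where c: "c \<in> A j" "c \<in> B k" using ex K ne by blast
  have "a = b" "b = c" using uniq[of i a b] uniq'[of k b c] a b c K by auto
  then show False using a c disjoint[OF K(2)] by blast
qed

theorem theorem1p6:
  fixes n m :: nat and A B :: "nat \<Rightarrow> 'a set"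
  assumes "n \<ge> 1"
    and "cross_intersecting_SPS m A B"
    and "bounded_SPS n n m A B"
    and "one_cross_intersecting m A B"
    and "linear_family m A"
    and "linear_family m B"
  shows "real m \<le> 1 / 2 * real n ^ 2 + real n + 1"
proof -
  have sys: "linear_one_cross {1..m} A B n"
    using assms(2-)
    unfolding cross_intersecting_SPS_def bounded_SPS_def one_cross_intersecting_def linear_family_def
    by unfold_locales auto
  have "2 * m \<le> n * (n + 2) + 2"
  proof (rule ccontr)
    assume "\<not> ?thesis"
    then have big: "n * (n + 2) + 3 \<le> 2 * m" by simp
    have "3 \<le> m" using big \<open>n \<ge> 1\<close> mult_le_mono[of 1 n 3 "n + 2"] by linarith
    then have "2 \<le> n" using two_le_of_card_ge_3[OF sys] by simp
    have "2 * n + 2 \<le> m \<and> 5 * n + 2 \<le> 2 * m"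
    \<comment> \<open>For \<open>n = 2\<close> parity is needed: \<open>2 m \<ge> 11\<close> gives \<open>m \<ge> 6\<close>, which is exactly enough.\<close>
    proof (cases "n = 2")
      case True
      then show ?thesis using big by simp
    next
      case False
      then have "n * 5 \<le> n * (n + 2)" using \<open>2 \<le> n\<close> by (intro mult_le_mono) auto
      then show ?thesis using big False \<open>2 \<le> n\<close> by linarith
    qed
    then have "2 * m \<le> n * (n + 2) + 2"
      using linear_one_cross.card_K_le[OF sys] by simp
    then show False using big by simp
  qed
  then have "real (2 * m) \<le> real (n * (n + 2) + 2)" by (rule of_nat_mono)
  then show ?thesis by (simp add: power2_eq_square algebra_simps)
qed

end
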